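(* Let $G=(\mathcal V,\mathcal E)$ be a (finite) $2$-dimensional simplicial complex with edge set $\mathcal E_1$ and triangle set $\mathcal E_2$. Suppose there is an injective map $f:\mathcal E_2\to\mathcal E_1$ with $f(T)\subset T$ for every $T\in\mathcal E_2$, such that no triangle $T\in\mathcal E_2$ has all three of its edges in the image of $f$. Then edge area transferal holds for $G$.
   Context: A hypergraph is a pair $(\mathcal V,\mathcal E)$ with $\mathcal V$ a finite set (vertices) and $\mathcal E\subset 2^{\mathcal V}$ (hyperedges). It is a simplicial complex if whenever $e\in\mathcal E$ and $f\subset e$ with $|f|>1$, then $f\in\mathcal E$. It is $2$-dimensional when all hyperedges have cardinality $2$ or $3$. $\mathcal E_1$ denotes the set of hyperedges of cardinality $2$ (edges) and $\mathcal E_2$ the set of hyperedges of cardinality $3$ ($2$-simplices, or triangles). Let $\alpha(x,y,z)=-\frac{x^2}{2}-\frac{y^2}{2}-\frac{z^2}{2}+xy+xz+yz$ (by Heron's formula, up to a constant factor, the squared area of a triangle as a function of its squared side lengths). The length-to-area map of $G$ is the polynomial map $\Phi:\mathbb R^{\mathcal E_1}\to\mathbb R^{\mathcal E_2}$ whose coordinate at the triangle $T=\{u,v,w\}\in\mathcal E_2$ is $\Phi(t)_T=\alpha(t_{\{u,v\}},t_{\{u,w\}},t_{\{v,w\}})$. Edge area transferal (also called length-area transferal) holds for $G$ if there is some input $t\in\mathbb R^{\mathcal E_1}$ at which the derivative matrix $D\Phi(t)$ has full row rank $|\mathcal E_2|$. *)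

theory Defs
  imports "HOL-Analysis.Analysis" "HOL-Library.Function_Algebras"
begin

definition hypergraph :: "'v set \<Rightarrow> 'v set set \<Rightarrow> bool" where
  "hypergraph V E \<longleftrightarrow> finite V \<and> E \<subseteq> Pow V"

definition abstract_simplicial_complex :: "'v set \<Rightarrow> 'v set set \<Rightarrow> bool" where
  "abstract_simplicial_complex V E \<longleftrightarrow>
     hypergraph V E \<and> (\<forall>e\<in>E. \<forall>f. f \<subseteq> e \<and> card f > 1 \<longrightarrow> f \<in> E)"

definition two_dimensional :: "'v set set \<Rightarrow> bool" where
  "two_dimensional E \<longleftrightarrow> (\<forall>e\<in>E. card e = 2 \<or> card e = 3)"

definition edges :: "'v set set \<Rightarrow> 'v set set" where
  "edges E = {e \<in> E. card e = 2}"

definition triangles :: "'v set set \<Rightarrow> 'v set set" where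
  "triangles E = {T \<in> E. card T = 3}"

definition heron_alpha :: "real \<Rightarrow> real \<Rightarrow> real \<Rightarrow> real" where
  "heron_alpha x y z = - (x\<^sup>2 / 2) - y\<^sup>2 / 2 - z\<^sup>2 / 2 + x * y + x * z + y * z"

text \<open>
  For a finite set \<open>I\<close>, the space of real vectors indexed by \<open>I\<close> is represented by
  the extensional functions \<open>I \<rightarrow>\<^sub>E UNIV\<close>.
  The coordinate at \<open>T\<close> does not depend on how the vertices of \<open>T\<close> are labelled, so the
  definite description below is well defined; see \<open>length_area_map_triangle\<close>.
\<close>

definition length_area_map :: "'v set set \<Rightarrow> ('v set \<Rightarrow> real) \<Rightarrow> 'v set \<Rightarrow> real" where
  "length_area_map E t = (\<lambda>T\<in>triangles E.
     THE a. \<exists>u v w. T = {u, v, w} \<and> u \<noteq> v \<and> u \<noteq> w \<and> v \<noteq> w \<and>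
       a = heron_alpha (t {u, v}) (t {u, w}) (t {v, w}))"

lemma length_area_map_triangle:
  assumes T: "{u, v, w} \<in> triangles E"
  shows "length_area_map E t {u, v, w} = heron_alpha (t {u, v}) (t {u, w}) (t {v, w})"
proof -
  have "card {u, v, w} = 3"
    using T by (simp add: triangles_def)
  then have d: "u \<noteq> v" "u \<noteq> w" "v \<noteq> w"
    by (auto simp: card_insert_if split: if_splits)
  have "(THE a. \<exists>u' v' w'. {u, v, w} = {u', v', w'} \<and> u' \<noteq> v' \<and> u' \<noteq> w' \<and> v' \<noteq> w' \<and>
      a = heron_alpha (t {u', v'}) (t {u', w'}) (t {v', w'})) =
    heron_alpha (t {u, v}) (t {u, w}) (t {v, w})"
  proof (rule the_equality)
    fix a
    assume "\<exists>u' v' w'. {u, v, w} = {u', v', w'} \<and> u' \<noteq> v' \<and> u' \<noteq> w' \<and> v' \<noteq> w' \<and>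
      a = heron_alpha (t {u', v'}) (t {u', w'}) (t {v', w'})"
    then obtain x y z where xyz: "{u, v, w} = {x, y, z}" "x \<noteq> y" "x \<noteq> z" "y \<noteq> z"
      and a: "a = heron_alpha (t {x, y}) (t {x, z}) (t {y, z})"
      by blast
    have "(x = u \<and> y = v \<and> z = w) \<or> (x = u \<and> y = w \<and> z = v) \<or>
          (x = v \<and> y = u \<and> z = w) \<or> (x = v \<and> y = w \<and> z = u) \<or>
          (x = w \<and> y = u \<and> z = v) \<or> (x = w \<and> y = v \<and> z = u)"
      using xyz d by (smt (verit) insert_iff singletonD)
    then show "a = heron_alpha (t {u, v}) (t {u, w}) (t {v, w})"
      using a by (auto simp: heron_alpha_def insert_commute algebra_simps)
  qed (use d in blast)
  then show ?thesis
    using T by (simp add: length_area_map_def)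
qed

text \<open>
  The \<open>(T, e)\<close> entry of the derivative matrix is the partial derivative of the
  \<open>T\<close>-coordinate with respect to the \<open>e\<close>-coordinate.
\<close>

definition length_area_derivative ::
    "'v set set \<Rightarrow> ('v set \<Rightarrow> real) \<Rightarrow> 'v set \<Rightarrow> 'v set \<Rightarrow> real" where
  "length_area_derivative E t T e = deriv (\<lambda>s. length_area_map E (t(e := s)) T) (t e)"

global_interpretation fun_vec: vector_space "\<lambda>(c::real) (f::'a \<Rightarrow> real) x. c * f x"
  defines fun_dim = fun_vec.dim
  by unfold_locales (auto simp: fun_eq_iff algebra_simps)

text \<open>
  The rank of the matrix with rows indexed by \<open>I\<close>, columns indexed by \<open>J\<close> and entries
  \<open>A i j\<close>, as in the library's definition of \<open>rank\<close>, is the dimension of the span of the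
  rows.  The rows are extended by \<open>0\<close> off \<open>J\<close>.
\<close>

definition indexed_rank :: "'i set \<Rightarrow> 'j set \<Rightarrow> ('i \<Rightarrow> 'j \<Rightarrow> real) \<Rightarrow> nat" where
  "indexed_rank I J A = fun_dim ((\<lambda>i j. if j \<in> J then A i j else 0) ` I)"

definition edge_area_transferal :: "'v set set \<Rightarrow> bool" where
  "edge_area_transferal E \<longleftrightarrow>
     (\<exists>t \<in> edges E \<rightarrow>\<^sub>E UNIV.
        indexed_rank (triangles E) (edges E) (length_area_derivative E t) = card (triangles E))"

end

theory Submission
  imports Defs "HOL-Combinatorics.Orbits"
begin

text \<open>
  Put \<open>t = 1\<close> on the edges outside the image of \<open>f\<close>. Every triangle \<open>T\<close> has, besides \<open>f T\<close>, at most
  one edge in the image, say \<open>f (g T)\<close>; put \<open>g T = T\<close> if there is none. With \<open>\<tau> T = t (f T)\<close>, the row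
  of \<open>T\<close> restricted to the image has entries \<open>1 - (\<tau> T - \<tau> (g T))\<close> at \<open>f T\<close> and
  \<open>1 + (\<tau> T - \<tau> (g T))\<close> at \<open>f (g T)\<close>, or the single entry \<open>2 - \<tau> T\<close>. Two triangles sharing two edges
  are equal, so the nontrivial cycles of \<open>g\<close> have length at least \<open>3\<close>. Hence one can choose
  \<open>\<tau>\<close> so that \<open>\<tau> T - \<tau> (g T)\<close> is never \<open>-1\<close> and equals \<open>1\<close> exactly once on each nontrivial cycle. The
  row where it equals \<open>1\<close> yields a unit vector, and following the rows around the cycle, and then
  backwards along the trees attached to it, yields all the others.
\<close>

section \<open>Unit vectors and the rank of a matrix\<close>

definition unit_fun :: "'a \<Rightarrow> 'a \<Rightarrow> real" where
  "unit_fun a = (\<lambda>x. if x = a then 1 else 0)"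

lemma inj_unit_fun: "inj unit_fun"
  by (rule injI) (metis unit_fun_def zero_neq_one)

lemma sum_fun_apply: "(\<Sum>i\<in>I. F i) x = (\<Sum>i\<in>I. F i x :: real)"
  by (induction I rule: infinite_finite_induct) auto

text \<open>Evaluating a vanishing combination at \<open>a\<close> leaves only the coefficient of
  \<open>unit_fun a\<close>, because every other unit function is \<open>0\<close> there.\<close>

lemma independent_unit_funs: "fun_vec.independent (unit_fun ` J)"
proof
  assume "fun_vec.dependent (unit_fun ` J)"
  then obtain T u where T: "finite T" "T \<subseteq> unit_fun ` J" "(\<Sum>v\<in>T. (\<lambda>x. u v * v x)) = 0"
    and "\<exists>v\<in>T. u v \<noteq> 0"
    unfolding fun_vec.dependent_explicit by blast
  then obtain v where v: "v \<in> T" "u v \<noteq> 0" by blast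
  then obtain a where a: "v = unit_fun a" using T by blast
  have "(\<Sum>w\<in>T. u w * w a) = 0"
    using T(3) by (metis (no_types, lifting) sum.cong sum_fun_apply zero_fun_apply)
  moreover have "(\<Sum>w\<in>T. u w * w a) = (\<Sum>w\<in>T. if w = v then u v else 0)"
  proof (intro sum.cong refl)
    fix w assume "w \<in> T"
    then obtain b where "w = unit_fun b" using T(2) by blast
    moreover from this have "w = v \<longleftrightarrow> b = a" by (simp add: a inj_eq[OF inj_unit_fun])
    ultimately show "u w * w a = (if w = v then u v else 0)"
      by (cases "b = a") (simp_all add: a unit_fun_def)
  qed
  ultimately show False using v T(1) by simp
qed

text \<open>
  The span condition is modulo the coordinates outside \<open>f ` I\<close>, so that a square minor suffices.
\<close>

lemma indexed_rank_eq_card: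
  assumes "finite I" "finite J" "inj_on f I" "f ` I \<subseteq> J"
    and span: "\<And>i. i \<in> I \<Longrightarrow> unit_fun (f i) \<in> fun_vec.span
      ((\<lambda>i j. if j \<in> J then A i j else 0) ` I \<union> unit_fun ` (J - f ` I))"
  shows "indexed_rank I J A = card I"
proof -
  define R where "R = (\<lambda>i j. if j \<in> J then A i j else 0) ` I"
  define D where "D = unit_fun ` (J - f ` I)"
  have fin: "finite R" "finite D" using assms by (auto simp: R_def D_def)
  obtain B where B: "B \<subseteq> R" "fun_vec.independent B" "R \<subseteq> fun_vec.span B" "card B = fun_vec.dim R"
    using fun_vec.basis_exists by blast
  \<comment> \<open>\<open>B\<close> spans the rows, so exchanging \<open>R\<close> for
    \<open>B\<close> beside \<open>D\<close> loses nothing.\<close>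
  have "R \<union> D \<subseteq> fun_vec.span (B \<union> D)"
    using B(3) fun_vec.span_mono[of B "B \<union> D"] fun_vec.span_superset[of "B \<union> D"] by auto
  then have sub: "fun_vec.span (R \<union> D) \<subseteq> fun_vec.span (B \<union> D)"
    by (simp add: fun_vec.span_minimal)
  have "unit_fun j \<in> fun_vec.span (B \<union> D)" if "j \<in> J" for j
  proof (cases "j \<in> f ` I")
    case True
    then show ?thesis using span sub by (auto simp: R_def D_def)
  next
    case False
    then show ?thesis using that by (auto simp: D_def intro: fun_vec.span_base)
  qed
  then have "unit_fun ` J \<subseteq> fun_vec.span (B \<union> D)" by auto
  moreover have "finite (B \<union> D)" using fin B(1) by (simp add: finite_subset)
  ultimately have "card (unit_fun ` J) \<le> card (B \<union> D)"
    using fun_vec.independent_span_bound independent_unit_funs by blast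
  also have "\<dots> \<le> card B + card D" by (rule card_Un_le)
  \<comment> \<open>The unit vectors outside the image account for only
    \<open>card J - card I\<close> of these, so \<open>B\<close> must supply at least
    \<open>card I\<close>.\<close>
  finally have "card J \<le> card B + card (J - f ` I)"
    by (simp add: D_def card_image inj_on_subset[OF inj_unit_fun])
  moreover have "card (J - f ` I) = card J - card I" "card I \<le> card J"
    using assms(1-4) by (simp_all add: card_Diff_subset card_image card_inj_on_le)
  moreover have "card B \<le> card I"
  proof -
    have "card B \<le> card R" using fin(1) B(1) by (rule card_mono)
    also have "\<dots> \<le> card I" unfolding R_def using assms(1) by (rule card_image_le)
    finally show ?thesis .
  qed
  ultimately have "fun_vec.dim R = card I" using B(4) by simp
  then show ?thesis by (simp add: indexed_rank_def R_def fun_dim_def)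
qed

section \<open>Cycles and trees of a self-map of a finite set\<close>

text \<open>The set \<open>S\<close> consists of one point from each cycle of length greater than \<open>1\<close>.\<close>

lemma exists_cycle_representatives:
  assumes "finite A" and g: "g ` A \<subseteq> A"
    and no2: "\<And>x. x \<in> A \<Longrightarrow> g (g x) = x \<Longrightarrow> g x = x"
  obtains S where "\<And>x. x \<in> S \<Longrightarrow> g x \<noteq> x \<and> g x \<notin> S \<and> g (g x) \<notin> S"
    and "\<And>P x. \<lbrakk>\<And>x. x \<in> A \<Longrightarrow> g x = x \<Longrightarrow> P x; \<And>x. x \<in> A \<Longrightarrow> P x \<Longrightarrow> P (g x);
           \<And>x. x \<in> A \<Longrightarrow> x \<in> S \<Longrightarrow> P (g x); \<And>x. x \<in> A \<Longrightarrow> x \<notin> S \<Longrightarrow> P (g x) \<Longrightarrow> P x; x \<in> A\<rbrakk> \<Longrightarrow> P x"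
proof -
  \<comment> \<open>\<open>orbit g x\<close> collects the iterates with positive exponent, so
    \<open>x \<in> orbit g x\<close> says that \<open>x\<close> is periodic. All points of a cycle
    have the same orbit set and hence the same \<open>SOME\<close> value, which singles out one of
    them.\<close>
  define S where "S = {x \<in> A. x \<in> orbit g x \<and> g x \<noteq> x \<and> x = (SOME y. y \<in> orbit g x)}"
  have sep: "g x \<noteq> x \<and> g x \<notin> S \<and> g (g x) \<notin> S" if x: "x \<in> S" for x
  proof -
    have o: "x \<in> orbit g x" "x \<in> A" using x by (auto simp: S_def)
    then have o1: "orbit g (g x) = orbit g x" by (simp add: self_in_orbit_step)
    then have "orbit g (g (g x)) = orbit g x" using orbit.base[of g x] self_in_orbit_step[of "g x" g] by simp
    \<comment> \<open>The three orbits coincide, so \<open>g x\<close> or \<open>g (g x)\<close>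
      could lie in \<open>S\<close> only by being equal to \<open>x\<close>; \<open>no2\<close>
      rules out the second case.\<close>
    then show ?thesis using x no2[of x] o1 unfolding S_def by auto
  qed
  have "P x" if fixed: "\<And>x. x \<in> A \<Longrightarrow> g x = x \<Longrightarrow> P x"
    and fwd: "\<And>x. x \<in> A \<Longrightarrow> P x \<Longrightarrow> P (g x)"
    and S: "\<And>x. x \<in> A \<Longrightarrow> x \<in> S \<Longrightarrow> P (g x)"
    and bwd: "\<And>x. x \<in> A \<Longrightarrow> x \<notin> S \<Longrightarrow> P (g x) \<Longrightarrow> P x" and "x \<in> A" for P x
  proof -
    have orbA: "orbit g x \<subseteq> A" if "x \<in> A" for x
    proof
      fix y assume "y \<in> orbit g x"
      then show "y \<in> A" by induction (use g that in auto)
    qed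
    have cyc: "P x" if x: "x \<in> A" "x \<in> orbit g x" for x
    proof (cases "g x = x")
      case False
      define s where "s = (SOME y. y \<in> orbit g x)"
      have s: "s \<in> orbit g x" unfolding s_def by (rule someI[of _ x]) (fact x)
      have xs: "x \<in> orbit g s" using orbit_swap[OF x(2) s] .
      have eq: "orbit g s = orbit g x" using s xs by (auto intro: orbit_trans)
      have "g s \<noteq> s"
      proof
        assume fix_s: "g s = s"
        have "y = s" if "y \<in> orbit g s" for y using that by induction (auto simp: fix_s)
        with xs fix_s False show False by auto
      qed
      moreover have "s \<in> A" using s x orbA by auto
      ultimately have "s \<in> S" using s eq unfolding S_def s_def by auto
      \<comment> \<open>The orbit of \<open>s\<close> starts at \<open>g s\<close>, where the
        hypothesis on \<open>S\<close> applies, and comes back to \<open>s\<close> only at the end;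
        \<open>P s\<close> is not presupposed.\<close>
      have "P y" if "y \<in> orbit g s" for y
        using that
      proof induction
        case base
        show ?case using S \<open>s \<in> S\<close> \<open>s \<in> A\<close> by blast
      next
        case (step y)
        then show ?case using fwd orbA \<open>s \<in> A\<close> by blast
      qed
      with xs show ?thesis by blast
    qed (use fixed x in blast)
    \<comment> \<open>Induction on a number \<open>n\<close> of steps that leads to a periodic
      point. A point of \<open>S\<close> cannot be reached by \<open>bwd\<close>, but it is periodic
      itself and covered by \<open>cyc\<close>.\<close>
    have "P x" if "x \<in> A" "(g ^^ n) x \<in> orbit g ((g ^^ n) x)" for n x
      using that
    proof (induction n arbitrary: x)
      case 0
      then show ?case using cyc by simp
    next
      case (Suc n)
      then have "P (g x)" using g by (auto simp: funpow_swap1)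
      then show ?case using bwd Suc.prems(1) cyc by (cases "x \<in> S") (auto simp: S_def)
    qed
    \<comment> \<open>Iterates in a finite set repeat, and a repeated value is periodic.\<close>
    moreover obtain n where "(g ^^ n) x \<in> orbit g ((g ^^ n) x)"
    proof -
      have "(g ^^ n) x \<in> A" for n by (induction n) (use g \<open>x \<in> A\<close> in auto)
      then have "finite (range (\<lambda>n. (g ^^ n) x))"
        using \<open>finite A\<close> by (auto intro: finite_subset[of _ A])
      then have "\<not> inj (\<lambda>n. (g ^^ n) x)" using range_inj_infinite by blast
      then obtain i j where "i < j" "(g ^^ i) x = (g ^^ j) x"
        by (metis injI linorder_neqE_nat)
      moreover from this have "(g ^^ j) x = (g ^^ (j - i)) ((g ^^ i) x)"
        by (metis add_diff_inverse_nat add.commute comp_apply funpow_add less_imp_not_less)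
      ultimately have "(g ^^ i) x \<in> orbit g ((g ^^ i) x)"
        unfolding orbit_altdef by (auto intro!: exI[of _ "j - i"])
      then show thesis by (rule that)
    qed
    ultimately show "P x" using \<open>x \<in> A\<close> by blast
  qed
  with sep show thesis by (rule that)
qed

section \<open>Rows of the derivative matrix\<close>

lemma length_area_derivative_edge:
  assumes T: "{u, v, w} \<in> triangles E"
  shows "length_area_derivative E t {u, v, w} {u, v} = t {u, w} + t {v, w} - t {u, v}"
proof -
  have "card {u, v, w} = 3" using T by (simp add: triangles_def)
  then have d: "u \<noteq> v" "u \<noteq> w" "v \<noteq> w" by (auto simp: card_insert_if split: if_splits)
  then have "(\<lambda>s. length_area_map E (t({u, v} := s)) {u, v, w}) =
      (\<lambda>s. heron_alpha s (t {u, w}) (t {v, w}))"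
    by (auto simp: length_area_map_triangle[OF T] doubleton_eq_iff)
  moreover have "((\<lambda>s. heron_alpha s (t {u, w}) (t {v, w})) has_real_derivative
      t {u, w} + t {v, w} - t {u, v}) (at (t {u, v}))"
    unfolding heron_alpha_def by (auto intro!: derivative_eq_intros)
  ultimately show ?thesis
    unfolding length_area_derivative_def by (simp add: DERIV_imp_deriv)
qed

lemma length_area_derivative_off:
  assumes T: "{u, v, w} \<in> triangles E" and "e \<noteq> {u, v}" "e \<noteq> {u, w}" "e \<noteq> {v, w}"
  shows "length_area_derivative E t {u, v, w} e = 0"
  using assms unfolding length_area_derivative_def by (simp add: length_area_map_triangle[OF T])

lemma length_area_derivative_row:
  assumes T: "{u, v, w} \<in> triangles E" and E: "{{u, v}, {u, w}, {v, w}} \<subseteq> edges E"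
  shows "(\<lambda>e. if e \<in> edges E then length_area_derivative E t {u, v, w} e else 0) =
    (\<lambda>e. (t {u, w} + t {v, w} - t {u, v}) * unit_fun {u, v} e) +
    (\<lambda>e. (t {u, v} + t {v, w} - t {u, w}) * unit_fun {u, w} e) +
    (\<lambda>e. (t {u, v} + t {u, w} - t {v, w}) * unit_fun {v, w} e)"
proof
  fix e
  have "card {u, v, w} = 3" using T by (simp add: triangles_def)
  then have d: "u \<noteq> v" "u \<noteq> w" "v \<noteq> w" by (auto simp: card_insert_if split: if_splits)
  \<comment> \<open>The derivative was computed for the edge on the first two vertices; relabelling
    the triangle yields the other two edges.\<close>
  have perm: "{u, w, v} = {u, v, w}" "{v, w, u} = {u, v, w}" by auto
  have "length_area_derivative E t {u, v, w} {u, v} = t {u, w} + t {v, w} - t {u, v}"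
    using length_area_derivative_edge[OF T] .
  moreover have "length_area_derivative E t {u, v, w} {u, w} = t {u, v} + t {v, w} - t {u, w}"
    using length_area_derivative_edge[of u w v E t] T by (simp add: perm insert_commute)
  moreover have "length_area_derivative E t {u, v, w} {v, w} = t {u, v} + t {u, w} - t {v, w}"
    using length_area_derivative_edge[of v w u E t] T unfolding perm by (simp add: insert_commute)
  moreover have "{u, v} \<noteq> {u, w}" "{u, v} \<noteq> {v, w}" "{u, w} \<noteq> {v, w}"
    using d by (auto simp: doubleton_eq_iff)
  moreover note length_area_derivative_off[OF T, of e t]
  ultimately show "(if e \<in> edges E then length_area_derivative E t {u, v, w} e else 0) =
    ((\<lambda>e. (t {u, w} + t {v, w} - t {u, v}) * unit_fun {u, v} e) +
    (\<lambda>e. (t {u, v} + t {v, w} - t {u, w}) * unit_fun {u, w} e) +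
    (\<lambda>e. (t {u, v} + t {u, w} - t {v, w}) * unit_fun {v, w} e)) e"
    using E unfolding unit_fun_def by (cases "e \<in> {{u, v}, {u, w}, {v, w}}") auto
qed

text \<open>One step of Gaussian elimination: subtract the two known terms and divide by
  \<open>a\<close>. A row of the derivative matrix has exactly three such terms.\<close>

lemma in_span_solve:
  assumes "r \<in> fun_vec.span W" "z \<in> fun_vec.span W" "y \<in> fun_vec.span W"
    and "r = (\<lambda>e. a * x e) + (\<lambda>e. b * y e) + (\<lambda>e. c * z e)" and "a \<noteq> 0"
  shows "x \<in> fun_vec.span W"
proof -
  have "(\<lambda>e. (1 / a) * (r - (\<lambda>e. b * y e) - (\<lambda>e. c * z e)) e) \<in> fun_vec.span W"
    using assms(1-3) by (intro fun_vec.span_scale fun_vec.span_diff)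
  also have "(\<lambda>e. (1 / a) * (r - (\<lambda>e. b * y e) - (\<lambda>e. c * z e)) e) = x"
    using assms(4,5) by (auto simp: fun_eq_iff)
  finally show ?thesis .
qed

theorem theorem1p1:
  fixes V :: "'v set" and E :: "'v set set" and f :: "'v set \<Rightarrow> 'v set"
  assumes "abstract_simplicial_complex V E" and "two_dimensional E"
    and "f ` triangles E \<subseteq> edges E"
    and "inj_on f (triangles E)"
    and "\<forall>T\<in>triangles E. f T \<subseteq> T"
    and "\<forall>T\<in>triangles E. \<not> (\<forall>e\<in>edges E. e \<subseteq> T \<longrightarrow> e \<in> f ` triangles E)"
  shows "edge_area_transferal E"
proof -
  let ?A = "triangles E"
  have "finite E"
    using assms(1) unfolding abstract_simplicial_complex_def hypergraph_def
    by (metis finite_Pow_iff finite_subset)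
  then have fin: "finite ?A" "finite (edges E)" by (auto simp: triangles_def edges_def)
  have edge: "e \<in> edges E" if "T \<in> ?A" "e \<subseteq> T" "card e = 2" for T e
    using assms(1) that unfolding abstract_simplicial_complex_def triangles_def edges_def by auto

  \<comment> \<open>The self-map \<open>g\<close> of the set of triangles\<close>
  have "\<exists>g. \<forall>T\<in>?A. \<exists>u v w. T = {u, v, w} \<and> u \<noteq> v \<and> u \<noteq> w \<and> v \<noteq> w \<and> f T = {u, v} \<and>
      {v, w} \<notin> f ` ?A \<and> g T \<in> ?A \<and>
      (if {u, w} \<in> f ` ?A then f (g T) = {u, w} else g T = T)"
  proof (intro bchoice ballI)
    fix T assume T: "T \<in> ?A"
    have "card T = 3" "f T \<subseteq> T" "card (f T) = 2"
      using T assms(3,5) by (auto simp: triangles_def edges_def)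
    then obtain p q where pq: "f T = {p, q}" "p \<noteq> q" by (auto simp: card_2_iff)
    have "card (T - f T) = 1" using \<open>card T = 3\<close> \<open>f T \<subseteq> T\<close> \<open>card (f T) = 2\<close>
      by (subst card_Diff_subset) (auto intro: card_ge_0_finite)
    then obtain w where "T - f T = {w}" by (auto simp: card_1_singleton_iff)
    then have Tw: "T = {p, q, w}" "w \<noteq> p" "w \<noteq> q" using pq \<open>f T \<subseteq> T\<close> by auto
    obtain e where e: "e \<in> edges E" "e \<subseteq> T" "e \<notin> f ` ?A" using assms(6) T by blast
    have "card e = 2" using e by (simp add: edges_def)
    then obtain a b where ab: "e = {a, b}" "a \<noteq> b" by (auto simp: card_2_iff)
    have "e \<noteq> {p, q}" using e T pq by auto
    \<comment> \<open>The edge \<open>e\<close> joins \<open>w\<close> to one end of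
      \<open>f T\<close>. That end is named \<open>v\<close>, so that \<open>{v, w}\<close> is
      outside the image and only \<open>{u, w}\<close> remains undecided.\<close>
    then consider "e = {p, w}" | "e = {q, w}" using ab e(2) Tw by auto
    then obtain u v where uv: "T = {u, v, w}" "u \<noteq> v" "u \<noteq> w" "v \<noteq> w" "f T = {u, v}" "{v, w} \<notin> f ` ?A"
    proof cases
      case 1
      show thesis by (rule that[of q p]) (use 1 pq Tw e(3) in auto)
    next
      case 2
      show thesis by (rule that[of p q]) (use 2 pq Tw e(3) in auto)
    qed
    obtain T' where "T' \<in> ?A \<and> (if {u, w} \<in> f ` ?A then f T' = {u, w} else T' = T)"
    proof (cases "{u, w} \<in> f ` ?A")
      case True
      then obtain T' where "{u, w} = f T'" "T' \<in> ?A" by (rule imageE)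
      with True show thesis by (intro that[of T']) simp
    next
      case False
      with T show thesis by (intro that[of T]) simp
    qed
    with uv show "\<exists>T' u v w. T = {u, v, w} \<and> u \<noteq> v \<and> u \<noteq> w \<and> v \<noteq> w \<and> f T = {u, v} \<and>
      {v, w} \<notin> f ` ?A \<and> T' \<in> ?A \<and>
      (if {u, w} \<in> f ` ?A then f T' = {u, w} else T' = T)"
      by (intro exI[of _ T'] exI[of _ u] exI[of _ v] exI[of _ w]) simp
  qed
  then obtain g where g: "\<And>T. T \<in> ?A \<Longrightarrow> \<exists>u v w. T = {u, v, w} \<and> u \<noteq> v \<and> u \<noteq> w \<and> v \<noteq> w \<and>
      f T = {u, v} \<and> {v, w} \<notin> f ` ?A \<and> g T \<in> ?A \<and>
      (if {u, w} \<in> f ` ?A then f (g T) = {u, w} else g T = T)"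
    by (elim exE) (rule that, rule bspec)
  have gA: "g ` ?A \<subseteq> ?A" using g by blast
  text \<open>If two triangles were exchanged by \<open>g\<close>, they would share two edges and hence coincide.\<close>
  have no2: "g T = T" if T: "T \<in> ?A" "g (g T) = T" for T
  proof (rule ccontr)
    assume "g T \<noteq> T"
    have gT: "g T \<in> ?A" using T gA by blast
    have sub: "f (g T) \<subseteq> T" if "T \<in> ?A" for T
      using g[OF that] assms(5) that by (auto split: if_splits)
    obtain u v w where "T = {u, v, w}" "f T = {u, v}" "f (g T) = {u, w}"
      using g[OF T(1)] \<open>g T \<noteq> T\<close> by (auto split: if_splits)
    moreover have "f (g (g T)) \<subseteq> g T" using sub[OF gT] .
    moreover have "f (g T) \<subseteq> g T" using assms(5) gT by blast
    \<comment> \<open>Both \<open>f T = f (g (g T))\<close> and \<open>f (g T)\<close> lie in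
      \<open>g T\<close>, and their union is all of \<open>T\<close>.\<close>
    ultimately have "T \<subseteq> g T" using T by auto
    moreover have "card T = 3" "card (g T) = 3" using T gT by (auto simp: triangles_def)
    ultimately show False using \<open>g T \<noteq> T\<close> by (metis card.infinite card_subset_eq zero_neq_numeral)
  qed

  \<comment> \<open>Choice of the edge lengths and elimination of the rows\<close>
  show ?thesis
  proof (rule exists_cycle_representatives[OF fin(1) gA])
    show "g T = T" if "T \<in> ?A" "g (g T) = T" for T
      using that by (rule no2)
  next
    fix S
    assume sep: "\<And>x. x \<in> S \<Longrightarrow> g x \<noteq> x \<and> g x \<notin> S \<and> g (g x) \<notin> S"
      and cover: "\<And>P x. \<lbrakk>\<And>x. x \<in> ?A \<Longrightarrow> g x = x \<Longrightarrow> P x; \<And>x. x \<in> ?A \<Longrightarrow> P x \<Longrightarrow> P (g x);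
        \<And>x. x \<in> ?A \<Longrightarrow> x \<in> S \<Longrightarrow> P (g x); \<And>x. x \<in> ?A \<Longrightarrow> x \<notin> S \<Longrightarrow> P (g x) \<Longrightarrow> P x; x \<in> ?A\<rbrakk> \<Longrightarrow> P x"
    \<comment> \<open>On \<open>S\<close> the difference \<open>\<tau> x - \<tau> (g x)\<close> is
      \<open>1 - 0\<close>. Off \<open>S\<close> the first value is at most \<open>1 / 2\<close>, so
      the difference is not \<open>1\<close>. A difference of \<open>-1\<close> would put
      \<open>x\<close> into the image of \<open>S\<close> under \<open>g\<close> and
      \<open>g x\<close> into \<open>S\<close>, against \<open>g (g x) \<notin> S\<close> for points
      of \<open>S\<close>.\<close>
    define \<tau> :: "'v set \<Rightarrow> real" where "\<tau> T = (if T \<in> S then 1 else if T \<in> g ` S then 0 else 1 / 2)" for T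
    define t where "t = (\<lambda>e\<in>edges E. if e \<in> f ` ?A then \<tau> (inv_into ?A f e) else 1)"
    have t_f: "t (f T) = \<tau> T" if "T \<in> ?A" for T
      using that assms(3,4) by (auto simp: t_def inv_into_f_f)
    have t_off: "t e = 1" if "e \<in> edges E" "e \<notin> f ` ?A" for e
      using that by (simp add: t_def)
    have \<tau>_S: "\<tau> x = 1" "\<tau> (g x) = 0" if "x \<in> S" for x
      using that sep by (auto simp: \<tau>_def)
    have \<tau>_le: "\<tau> x \<le> 1" for x by (simp add: \<tau>_def)
    have \<tau>_ne: "\<tau> x - \<tau> (g x) \<noteq> 1" if "x \<notin> S" for x
      using that by (simp add: \<tau>_def)
    have \<tau>_ne': "\<tau> x - \<tau> (g x) \<noteq> -1" for x
      using sep by (auto simp: \<tau>_def)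
    \<comment> \<open>The spanning set in \<open>indexed_rank_eq_card\<close>: directions outside
      the image of \<open>f\<close> are free.\<close>
    define W where "W = (\<lambda>T e. if e \<in> edges E then length_area_derivative E t T e else 0) ` ?A \<union>
      unit_fun ` (edges E - f ` ?A)"
    have off: "unit_fun e \<in> fun_vec.span W" if "e \<in> edges E" "e \<notin> f ` ?A" for e
      using that by (auto simp: W_def intro: fun_vec.span_base)
    have row: "(\<lambda>e. if e \<in> edges E then length_area_derivative E t T e else 0) \<in> fun_vec.span W"
      if "T \<in> ?A" for T
      using that by (auto simp: W_def intro: fun_vec.span_base)
    have row_eq: "\<exists>e e'. e \<in> edges E \<and> e' \<in> edges E \<and> e' \<notin> f ` ?A \<and> e \<noteq> f T \<and>
        (if e \<in> f ` ?A then f (g T) = e else g T = T) \<and>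
        (\<lambda>e. if e \<in> edges E then length_area_derivative E t T e else 0) =
          (\<lambda>x. (t e + t e' - t (f T)) * unit_fun (f T) x) +
          (\<lambda>x. (t (f T) + t e' - t e) * unit_fun e x) +
          (\<lambda>x. (t (f T) + t e - t e') * unit_fun e' x)"
      if T: "T \<in> ?A" for T
    proof -
      obtain u v w where uvw: "T = {u, v, w}" "u \<noteq> v" "u \<noteq> w" "v \<noteq> w"
        "f T = {u, v}" "{v, w} \<notin> f ` ?A"
        and gT: "if {u, w} \<in> f ` ?A then f (g T) = {u, w} else g T = T"
        using g[OF T] by (elim exE conjE) (rule that)
      have E: "{u, v} \<in> edges E" "{u, w} \<in> edges E" "{v, w} \<in> edges E"
        using edge[OF T] uvw by auto
      have ne: "{u, w} \<noteq> f T" using uvw by (auto simp: doubleton_eq_iff)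
      have "{u, v, w} \<in> ?A" using T uvw(1) by simp
      from length_area_derivative_row[OF this, of t, folded uvw(1,5)] E
      show ?thesis
        by (intro exI[of _ "{u, w}"] exI[of _ "{v, w}"] conjI E uvw(6) ne gT) (auto simp: uvw(5))
    qed
    have fixed: "unit_fun (f T) \<in> fun_vec.span W" if T: "T \<in> ?A" and "g T = T" for T
    proof -
      \<comment> \<open>If \<open>e\<close> were in the image, then \<open>f (g T) = e\<close> and
        \<open>g T = T\<close> would give \<open>e = f T\<close>.\<close>
      obtain e e' where e: "e \<in> edges E" "e' \<in> edges E" "e' \<notin> f ` ?A" "e \<notin> f ` ?A"
        and eq: "(\<lambda>e. if e \<in> edges E then length_area_derivative E t T e else 0) =
          (\<lambda>x. (t e + t e' - t (f T)) * unit_fun (f T) x) +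
          (\<lambda>x. (t (f T) + t e' - t e) * unit_fun e x) +
          (\<lambda>x. (t (f T) + t e - t e') * unit_fun e' x)"
        using row_eq[OF T] \<open>g T = T\<close> by (elim exE conjE) (rule that, auto split: if_splits)
      \<comment> \<open>The coefficient is \<open>2 - \<tau> T\<close>, which is at least
        \<open>1\<close>.\<close>
      have "t e + t e' - t (f T) \<noteq> 0" using e t_off t_f[OF T] \<tau>_le[of T] by simp
      then show ?thesis
        by (rule in_span_solve[OF row[OF T] off[OF e(2,3)] off[OF e(1,4)] eq])
    qed
    have step: "\<exists>r z c. r \<in> fun_vec.span W \<and> z \<in> fun_vec.span W \<and>
        r = (\<lambda>x. (1 - (\<tau> T - \<tau> (g T))) * unit_fun (f T) x) +
        (\<lambda>x. (1 + (\<tau> T - \<tau> (g T))) * unit_fun (f (g T)) x) + (\<lambda>x. c * z x)"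
      if T: "T \<in> ?A" and "g T \<noteq> T" for T
    proof -
      obtain e e' where e: "e' \<in> edges E" "e' \<notin> f ` ?A" "f (g T) = e"
        and eq: "(\<lambda>e. if e \<in> edges E then length_area_derivative E t T e else 0) =
          (\<lambda>x. (t e + t e' - t (f T)) * unit_fun (f T) x) +
          (\<lambda>x. (t (f T) + t e' - t e) * unit_fun e x) +
          (\<lambda>x. (t (f T) + t e - t e') * unit_fun e' x)"
        using row_eq[OF T] \<open>g T \<noteq> T\<close> by (elim exE conjE) (rule that, auto split: if_splits)
      have "g T \<in> ?A" using T gA by blast
      then have te: "t e = \<tau> (g T)" "t e' = 1" "t (f T) = \<tau> T"
        using t_f[of "g T"] t_f[OF T] e t_off by auto
      \<comment> \<open>Length \<open>1\<close> on the third edge makes both coefficients depend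
        only on the difference of \<tau> along \<open>g\<close>.\<close>
      have "t e + t e' - t (f T) = 1 - (\<tau> T - \<tau> (g T))"
        and "t (f T) + t e' - t e = 1 + (\<tau> T - \<tau> (g T))" by (simp_all add: te)
      note eq' = eq[unfolded this, folded e(3)]
      show ?thesis
        by (rule exI, rule exI[of _ "unit_fun e'"], rule exI, intro conjI)
          (rule row[OF T], rule off[OF e(1,2)], rule eq')
    qed
    have "unit_fun (f T) \<in> fun_vec.span W" if "T \<in> ?A" for T
    proof (rule cover[of "\<lambda>T. unit_fun (f T) \<in> fun_vec.span W", OF _ _ _ _ that])
      fix T assume T: "T \<in> ?A"
      show "unit_fun (f T) \<in> fun_vec.span W" if "g T = T" by (rule fixed[OF T that])
      show "unit_fun (f (g T)) \<in> fun_vec.span W" if fT: "unit_fun (f T) \<in> fun_vec.span W"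
      proof (cases "g T = T")
        case False
        from step[OF T this] obtain r z c where rz: "r \<in> fun_vec.span W" "z \<in> fun_vec.span W"
          and r: "r = (\<lambda>x. (1 - (\<tau> T - \<tau> (g T))) * unit_fun (f T) x) +
            (\<lambda>x. (1 + (\<tau> T - \<tau> (g T))) * unit_fun (f (g T)) x) + (\<lambda>x. c * z x)"
          by (elim exE conjE) (rule that)
        have "1 + (\<tau> T - \<tau> (g T)) \<noteq> 0" using \<tau>_ne'[of T] by simp
        then show ?thesis
          \<comment> \<open>The sum is commuted to bring the term of \<open>f (g T)\<close>, which
            is solved for, to the front.\<close>
          by (rule in_span_solve[OF rz fT r[unfolded add.commute[of "\<lambda>x. _ * unit_fun (f T) x"]]])
      qed (use fT in simp)
      show "unit_fun (f (g T)) \<in> fun_vec.span W" if "T \<in> S"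
      proof -
        have "g T \<noteq> T" using sep[OF that] by blast
        from step[OF T this] obtain r z c where rz: "r \<in> fun_vec.span W" "z \<in> fun_vec.span W"
          and r: "r = (\<lambda>x. (1 - (\<tau> T - \<tau> (g T))) * unit_fun (f T) x) +
            (\<lambda>x. (1 + (\<tau> T - \<tau> (g T))) * unit_fun (f (g T)) x) + (\<lambda>x. c * z x)"
          by (elim exE conjE) (rule that)
        \<comment> \<open>The difference is \<open>1\<close> here, so the term of \<open>f T\<close>
          drops out and the row alone yields the first unit vector on the cycle. The zero multiple
          of \<open>z\<close> only keeps the three-term shape.\<close>
        have "r = (\<lambda>x. 2 * unit_fun (f (g T)) x) + (\<lambda>x. 0 * z x) + (\<lambda>x. c * z x)"
          unfolding r using \<tau>_S[OF that] by (simp add: fun_eq_iff)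
        then show ?thesis by (rule in_span_solve[OF rz rz(2)]) simp
      qed
      show "unit_fun (f T) \<in> fun_vec.span W"
        if "T \<notin> S" and fgT: "unit_fun (f (g T)) \<in> fun_vec.span W"
      proof (cases "g T = T")
        case False
        from step[OF T this] obtain r z c where rz: "r \<in> fun_vec.span W" "z \<in> fun_vec.span W"
          and r: "r = (\<lambda>x. (1 - (\<tau> T - \<tau> (g T))) * unit_fun (f T) x) +
            (\<lambda>x. (1 + (\<tau> T - \<tau> (g T))) * unit_fun (f (g T)) x) + (\<lambda>x. c * z x)"
          by (elim exE conjE) (rule that)
        have "1 - (\<tau> T - \<tau> (g T)) \<noteq> 0" using \<tau>_ne[OF that(1)] by simp
        then show ?thesis by (rule in_span_solve[OF rz fgT r])
      qed (use fgT in simp)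
    qed
    then have "indexed_rank ?A (edges E) (length_area_derivative E t) = card ?A"
      using fin assms(3,4) by (intro indexed_rank_eq_card[where f = f]) (auto simp: W_def)
    moreover have "t \<in> edges E \<rightarrow>\<^sub>E UNIV" by (simp add: t_def)
    ultimately show ?thesis unfolding edge_area_transferal_def by blast
  qed
qed

end
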